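(* Let $E$ be a real uniformly smooth and uniformly convex Banach space and let $C$ be a nonempty closed convex subset of $E$. Let $T_1,\dots,T_N : C\to C$ be a finite family of asymptotically quasi $\phi$-nonexpansive mappings with a common sequence $\{k_n\}_{n\ge 0}\subset[1,+\infty)$, $k_n\to 1$. Suppose that for each $i=1,\dots,N$ the mapping $T_i$ is uniformly $L_i$-Lipschitz continuous for some $L_i>0$, and that the set $F=\bigcap_{i=1}^N F(T_i)$ is nonempty and bounded in $C$, i.e. there is a positive number $\omega$ such that $F\subset\Omega:=\{u\in C:\|u\|\le\omega\}$. Let $\{\alpha_n\}_{n\ge 0}$ be a sequence in $[0,1]$ with $\lim_{n\to\infty}\alpha_n=0$. Let $\{x_n\}$ be the sequence generated by $x_0\in C$, $C_0:=C$, and, for $n\ge 0$, $$y_n^i=J^{-1}\left(\alpha_n Jx_0+(1-\alpha_n)JT_i^n x_n\right),\quad i=1,\dots,N,$$ $$i_n\in\arg\max_{1\le i\le N}\|y_n^i-x_n\|,\qquad \bar y_n:=y_n^{i_n},$$ $$C_{n+1}:=\{v\in C_n:\phi(v,\bar y_n)\le\alpha_n\phi(v,x_0)+(1-\alpha_n)\phi(v,x_n)+\epsilon_n\},$$ $$x_{n+1}=\Pi_{C_{n+1}}x_0,$$ where $\epsilon_n:=(k_n-1)(\omega+\|x_n\|)^2$. Then $\{x_n\}$ converges strongly to $x^\dagger:=\Pi_F x_0$.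
   Context: Let $E$ be a smooth, strictly convex, reflexive real Banach space with dual $E^*$. $J:E\to E^*$ is the normalized duality mapping: $J(x)$ is the unique $f\in E^*$ with $\langle f,x\rangle=\|x\|^2=\|f\|^2$; it is a bijection. The Lyapunov functional is $\phi(x,y)=\|x\|^2-2\langle x,Jy\rangle+\|y\|^2$ for $x,y\in E$. For a nonempty closed convex $K\subset E$, the generalized projection $\Pi_K:E\to K$ is $\Pi_K(x)=\arg\min_{y\in K}\phi(y,x)$. For $T:C\to C$, $F(T)$ is the set of fixed points of $T$, $T^n$ is the $n$-th iterate and $T^0$ is the identity. $T$ is asymptotically quasi $\phi$-nonexpansive with sequence $\{k_n\}\subset[1,+\infty)$, $k_n\to1$, if $F(T)\neq\emptyset$ and $\phi(p,T^nx)\le k_n\phi(p,x)$ for all $n\ge1$, $p\in F(T)$, $x\in C$. $T$ is uniformly $L$-Lipschitz continuous ($L>0$) if $\|T^nx-T^ny\|\le L\|x-y\|$ for all $n\ge1$ and $x,y\in C$. *)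

theory Defs
  imports "HOL-Analysis.Analysis"
begin

definition uniformly_convex :: "'a::real_normed_vector itself \<Rightarrow> bool" where
  "uniformly_convex _ \<longleftrightarrow>
     (\<forall>\<epsilon>::real. 0 < \<epsilon> \<and> \<epsilon> \<le> 2 \<longrightarrow>
       (\<exists>\<delta>>0. \<forall>x y :: 'a. norm x = 1 \<and> norm y = 1 \<and> norm (x - y) \<ge> \<epsilon> \<longrightarrow>
          norm ((x + y) /\<^sub>R 2) \<le> 1 - \<delta>))"

text \<open>The norm is Gateaux differentiable on the unit sphere \<open>S\<close>, with difference quotients
  converging uniformly on \<open>S \<times> S\<close>; \<open>d\<close> is the directional derivative.\<close>

definition uniformly_smooth :: "'a::real_normed_vector itself \<Rightarrow> bool" where
  "uniformly_smooth _ \<longleftrightarrow>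
     (\<exists>d :: 'a \<times> 'a \<Rightarrow> real.
        uniform_limit (sphere 0 1 \<times> sphere 0 1)
          (\<lambda>t (x, y). (norm (x + t *\<^sub>R y) - norm x) / t) d (at 0))"

text \<open>In a smooth space the description below determines \<open>f\<close> uniquely; if the space is moreover
  reflexive and strictly convex, the map is a bijection onto the dual, so that \<open>inv duality_map\<close>
  is its two-sided inverse. Uniformly smooth and uniformly convex Banach spaces have all these
  properties.\<close>

definition duality_map :: "'a::real_normed_vector \<Rightarrow> ('a \<Rightarrow>\<^sub>L real)" where
  "duality_map x = (THE f. blinfun_apply f x = (norm x)\<^sup>2 \<and> (norm f)\<^sup>2 = (norm x)\<^sup>2)"

definition lyapunov :: "'a::real_normed_vector \<Rightarrow> 'a \<Rightarrow> real" where
  "lyapunov x y = (norm x)\<^sup>2 - 2 * blinfun_apply (duality_map y) x + (norm y)\<^sup>2"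

definition gen_proj :: "'a::real_normed_vector set \<Rightarrow> 'a \<Rightarrow> 'a" where
  "gen_proj K x = arg_min_on (\<lambda>y. lyapunov y x) K"

definition fixed_points :: "'a set \<Rightarrow> ('a \<Rightarrow> 'a) \<Rightarrow> 'a set" where
  "fixed_points C T = {p \<in> C. T p = p}"

definition asymp_quasi_phi_nonexpansive ::
    "'a::real_normed_vector set \<Rightarrow> (nat \<Rightarrow> real) \<Rightarrow> ('a \<Rightarrow> 'a) \<Rightarrow> bool" where
  "asymp_quasi_phi_nonexpansive C k T \<longleftrightarrow>
     (\<forall>n. 1 \<le> k n) \<and> k \<longlonglongrightarrow> 1 \<and>
     fixed_points C T \<noteq> {} \<and>
     (\<forall>n\<ge>1. \<forall>p\<in>fixed_points C T. \<forall>x\<in>C. lyapunov p ((T ^^ n) x) \<le> k n * lyapunov p x)"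

definition uniformly_lipschitz :: "'a::metric_space set \<Rightarrow> real \<Rightarrow> ('a \<Rightarrow> 'a) \<Rightarrow> bool" where
  "uniformly_lipschitz C L T \<longleftrightarrow> 0 < L \<and> (\<forall>n\<ge>1. L-lipschitz_on C (T ^^ n))"

end

theory Submission
  imports Defs
begin

text \<open>Uniform convexity makes every functional \<open>v \<mapsto> \<parallel>v\<parallel>\<^sup>2 - 2 f v\<close> uniformly convex on bounded
  sets. This one fact yields the existence and uniqueness of generalized projections, the
  surjectivity of the duality map (minimize over the whole space), the implication from
  \<open>\<phi>(z, w\<^sub>n) \<rightarrow> 0\<close> to \<open>w\<^sub>n \<rightarrow> z\<close>, and the convergence of the projections of \<open>x\<^sub>0\<close> onto a
  decreasing sequence of closed convex sets. The last item makes \<open>x\<^sub>n\<close> converge to some \<open>x\<^sup>*\<close>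
  lying in all the sets \<open>C\<^sub>n\<close>; testing their definition with \<open>x\<^sup>*\<close> itself gives
  \<open>\<phi>(x\<^sup>*, y\<^sub>n) \<rightarrow> 0\<close>, hence \<open>T\<^sub>i\<^sup>n x\<^sub>n \<rightarrow> x\<^sup>*\<close>, and the Lipschitz condition makes \<open>x\<^sup>*\<close> a common
  fixed point. Smoothness is needed only for the duality map to be well defined; \<open>J x\<close> is a
  multiple of the derivative of the norm at \<open>x\<close>, so no Hahn-Banach argument is required.\<close>

section \<open>Uniform convexity of the squared norm\<close>

text \<open>Dividing by the common norm reduces this to the unit sphere; the bound \<open>R\<close>
  keeps the normalized vectors at least \<open>\<epsilon> / R\<close> apart.\<close>

lemma uniformly_convex_norm_midpoint:
  fixes \<epsilon> R :: real
  assumes uc: "uniformly_convex TYPE('a::real_normed_vector)" and "0 < \<epsilon>" "0 < R"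
  obtains \<delta> where "0 < \<delta>"
    "\<And>u v :: 'a. \<lbrakk>norm u = norm v; 0 < norm u; norm u \<le> R; \<epsilon> \<le> norm (u - v)\<rbrakk>
      \<Longrightarrow> norm ((u + v) /\<^sub>R 2) \<le> norm u * (1 - \<delta>)"
proof -
  \<comment> \<open>The cap is there because uniform convexity is stated only for separations up to
    2.\<close>
  define \<epsilon>' where "\<epsilon>' = min 2 (\<epsilon> / R)"
  have "0 < \<epsilon>'" "\<epsilon>' \<le> 2"
    using assms by (auto simp: \<epsilon>'_def)
  then obtain \<delta> where "0 < \<delta>" and
    \<delta>: "\<And>x y :: 'a. norm x = 1 \<Longrightarrow> norm y = 1 \<Longrightarrow> \<epsilon>' \<le> norm (x - y) \<Longrightarrow> norm ((x + y) /\<^sub>R 2) \<le> 1 - \<delta>"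
    using uc unfolding uniformly_convex_def by meson
  have "norm ((u + v) /\<^sub>R 2) \<le> norm u * (1 - \<delta>)"
    if "norm u = norm v" and pos: "0 < norm u" and "norm u \<le> R" "\<epsilon> \<le> norm (u - v)" for u v :: 'a
  proof -
    let ?a = "norm u"
    have scale: "norm (w /\<^sub>R ?a) = norm w / ?a" for w :: 'a
      by (simp only: norm_scaleR abs_inverse abs_norm_cancel divide_inverse_commute)
    have "\<epsilon> / R \<le> norm (u - v) / ?a"
      using that assms by (intro frac_le) auto
    also have "\<dots> = norm (u /\<^sub>R ?a - v /\<^sub>R ?a)"
      by (simp only: scale flip: scaleR_diff_right)
    finally have "\<epsilon>' \<le> norm (u /\<^sub>R ?a - v /\<^sub>R ?a)"
      by (simp add: \<epsilon>'_def)
    then have "norm ((u /\<^sub>R ?a + v /\<^sub>R ?a) /\<^sub>R 2) \<le> 1 - \<delta>"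
      using that by (intro \<delta>) auto
    moreover have "(u /\<^sub>R ?a + v /\<^sub>R ?a) /\<^sub>R 2 = ((u + v) /\<^sub>R 2) /\<^sub>R ?a"
      by (simp only: scaleR_add_right scaleR_scaleR mult.commute)
    ultimately have "norm ((u + v) /\<^sub>R 2) / ?a \<le> 1 - \<delta>"
      by (simp only: scale)
    then show ?thesis
      unfolding pos_divide_le_eq[OF pos] by (simp only: mult.commute)
  qed
  with \<open>0 < \<delta>\<close> show ?thesis by (rule that)
qed

text \<open>Either the norms differ, and averaging their squares already leaves a gap, or they
  nearly agree, and rescaling the shorter vector to the norm of the longer one reduces to the
  previous lemma.\<close>

lemma uniformly_convex_norm_square:
  fixes \<epsilon> R :: real
  assumes uc: "uniformly_convex TYPE('a::real_normed_vector)" and e: "0 < \<epsilon>"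
  obtains \<delta> where "0 < \<delta>"
    "\<And>u v :: 'a. \<lbrakk>norm u \<le> R; norm v \<le> R; \<epsilon> \<le> norm (u - v)\<rbrakk>
      \<Longrightarrow> (norm ((u + v) /\<^sub>R 2))\<^sup>2 \<le> ((norm u)\<^sup>2 + (norm v)\<^sup>2) / 2 - \<delta>"
proof -
  \<comment> \<open>\<open>R\<close> may be nonpositive, hence \<open>max R 1\<close>; half of
    \<open>\<epsilon>\<close> is given up to the rescaling of \<open>v\<close>.\<close>
  obtain \<delta> where "0 < \<delta>" and
    \<delta>: "\<And>u v :: 'a. \<lbrakk>norm u = norm v; 0 < norm u; norm u \<le> max R 1; \<epsilon> / 2 \<le> norm (u - v)\<rbrakk>
      \<Longrightarrow> norm ((u + v) /\<^sub>R 2) \<le> norm u * (1 - \<delta>)"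
    by (rule uniformly_convex_norm_midpoint[OF uc, of "\<epsilon> / 2" "max R 1"]) (use e in auto)
  \<comment> \<open>The first bound keeps \<open>v\<close> nonzero and its rescaling
    \<open>\<epsilon> / 2\<close> away from \<open>u\<close>; the second keeps the rescaling errors
    to at most half of the gain \<open>a * \<delta>\<close>. Then \<open>\<gamma>\<close> is the
    smaller gain of the two cases.\<close>
  define \<eta> where "\<eta> = min (\<epsilon> / 4) (\<epsilon> * \<delta> / 4)"
  define \<gamma> where "\<gamma> = min (\<eta>\<^sup>2 / 4) (\<epsilon> * \<delta> / 4 * (\<epsilon> / 4))"
  have \<eta>: "0 < \<eta>" "\<eta> \<le> \<epsilon> / 4" "\<eta> \<le> \<epsilon> * \<delta> / 4"
    using e \<open>0 < \<delta>\<close> by (auto simp: \<eta>_def)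
  have \<gamma>: "0 < \<gamma>" "\<gamma> \<le> \<eta>\<^sup>2 / 4" "\<gamma> \<le> \<epsilon> * \<delta> / 4 * (\<epsilon> / 4)"
    using e \<eta>(1) \<open>0 < \<delta>\<close> by (auto simp: \<gamma>_def)
  have *: "(norm ((u + v) /\<^sub>R 2))\<^sup>2 \<le> ((norm u)\<^sup>2 + (norm v)\<^sup>2) / 2 - \<gamma>"
    if "norm u \<le> R" "norm v \<le> norm u" "\<epsilon> \<le> norm (u - v)" for u v :: 'a
  proof -
    define a b where "a = norm u" and "b = norm v"
    define Q where "Q = norm ((u + v) /\<^sub>R 2)"
    have "b \<le> a" "0 \<le> b" "0 \<le> Q" using that by (auto simp: a_def b_def Q_def)
    have "\<epsilon> \<le> a + b"
      using norm_triangle_ineq4[of u v] that(3) by (simp add: a_def b_def)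
    with \<open>b \<le> a\<close> have a: "\<epsilon> / 2 \<le> a" by simp
    have Q1: "Q \<le> (a + b) / 2"
      using norm_triangle_ineq[of u v] by (simp add: Q_def a_def b_def)
    have mean: "(a\<^sup>2 + b\<^sup>2) / 2 = ((a + b) / 2)\<^sup>2 + (a - b)\<^sup>2 / 4"
      by (simp add: power2_eq_square field_simps)
    have "Q\<^sup>2 \<le> (a\<^sup>2 + b\<^sup>2) / 2 - \<gamma>"
    proof (cases "\<eta> \<le> a - b")
      case True
      have "Q\<^sup>2 \<le> ((a + b) / 2)\<^sup>2" using Q1 \<open>0 \<le> Q\<close> by (rule power_mono)
      moreover have "\<eta>\<^sup>2 \<le> (a - b)\<^sup>2" using True \<eta>(1) by (intro power_mono) auto
      ultimately show ?thesis using \<gamma>(2) mean by linarith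
    next
      case False
      have "0 < b" "0 < a" using False a e \<eta>(2) by auto
      define w where "w = (a / b) *\<^sub>R v"
      have w: "norm w = a"
        using \<open>0 < b\<close> \<open>0 < a\<close> by (simp add: w_def) (simp add: b_def)
      have "v - w = ((b - a) / b) *\<^sub>R v"
        using \<open>0 < b\<close> by (simp add: w_def diff_divide_distrib scaleR_diff_left)
      then have vw: "norm (v - w) = a - b"
        using \<open>0 < b\<close> \<open>b \<le> a\<close> by (simp flip: b_def)
      have "norm (u - v) \<le> norm (u - w) + norm (v - w)"
        using norm_triangle_ineq4[of "u - w" "v - w"] by simp
      with vw False that(3) \<eta>(2) e have "\<epsilon> / 2 \<le> norm (u - w)" by linarith
      then have mid: "norm ((u + w) /\<^sub>R 2) \<le> a * (1 - \<delta>)"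
        unfolding a_def using w that(1) \<open>0 < a\<close> by (intro \<delta>) (auto simp: a_def)
      have "(u + v) /\<^sub>R 2 = (u + w) /\<^sub>R 2 + (v - w) /\<^sub>R 2"
        by (simp add: algebra_simps)
      then have "Q \<le> norm ((u + w) /\<^sub>R 2) + norm ((v - w) /\<^sub>R 2)"
        unfolding Q_def by (metis norm_triangle_ineq)
      also have "\<dots> \<le> a * (1 - \<delta>) + \<eta> / 2"
        using mid by (rule add_mono) (use vw False in simp)
      finally have Q2: "Q \<le> a - a * \<delta> + \<eta> / 2" by (simp add: algebra_simps)
      define P where "P = (a + b) / 2"
      have "\<epsilon> / 2 * \<delta> \<le> a * \<delta>" using a \<open>0 < \<delta>\<close> by (intro mult_right_mono) auto
      moreover have "\<epsilon> / 2 * \<delta> = 2 * (\<epsilon> * \<delta> / 4)" by simp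
      moreover have "a - \<eta> / 2 \<le> P" using False by (simp add: P_def)
      ultimately have PQ: "\<epsilon> * \<delta> / 4 \<le> P - Q"
        using Q2 \<eta>(3) by linarith
      have "\<epsilon> / 4 \<le> P + Q"
        using \<open>\<epsilon> \<le> a + b\<close> e \<open>0 \<le> Q\<close> unfolding P_def by argo
      then have "\<epsilon> * \<delta> / 4 * (\<epsilon> / 4) \<le> (P - Q) * (P + Q)"
        using PQ e \<open>0 < \<delta>\<close> mult_pos_pos[OF e \<open>0 < \<delta>\<close>] by (intro mult_mono) linarith+
      then have "\<gamma> \<le> P\<^sup>2 - Q\<^sup>2"
        using \<gamma>(3) by (simp add: power2_eq_square algebra_simps)
      then show ?thesis using mean zero_le_power2[of "a - b"] unfolding P_def by linarith
    qed
    then show ?thesis by (simp only: Q_def a_def b_def)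
  qed
  have "(norm ((u + v) /\<^sub>R 2))\<^sup>2 \<le> ((norm u)\<^sup>2 + (norm v)\<^sup>2) / 2 - \<gamma>"
    if "norm u \<le> R" "norm v \<le> R" "\<epsilon> \<le> norm (u - v)" for u v :: 'a
  proof (cases "norm v \<le> norm u")
    case True
    with that show ?thesis by (intro *)
  next
    case False
    with that *[of v u] show ?thesis by (simp add: norm_minus_commute add.commute)
  qed
  with \<gamma>(1) show ?thesis by (rule that)
qed

section \<open>Minimizing the squared norm minus a linear functional\<close>

text \<open>For \<open>f = duality_map x\<close> this is \<open>lyapunov v x\<close> up to a
  constant. A general \<open>f\<close> is kept so that the same minimization also shows that every
  functional is a value of \<open>duality_map\<close>.\<close>

definition dual_energy :: "('a::real_normed_vector \<Rightarrow>\<^sub>L real) \<Rightarrow> 'a \<Rightarrow> real" where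
  "dual_energy f v = (norm v)\<^sup>2 - 2 * blinfun_apply f v"

lemma blinfun_le_norm: "blinfun_apply f v \<le> norm f * norm v" for f :: "'a::real_normed_vector \<Rightarrow>\<^sub>L real"
  using norm_blinfun[of f v] by simp

text \<open>Completes the square after \<open>blinfun_le_norm\<close>; as a consequence, sublevel
  sets are bounded.\<close>

lemma dual_energy_lower: "(norm v - norm f)\<^sup>2 - (norm f)\<^sup>2 \<le> dual_energy f v"
  using blinfun_le_norm[of f v] by (simp add: dual_energy_def power2_diff algebra_simps)

lemma dual_energy_ge: "- (norm f)\<^sup>2 \<le> dual_energy f v"
  using dual_energy_lower[of v f] zero_le_power2[of "norm v - norm f"] by linarith

lemma tendsto_dual_energy [tendsto_intros]:
  "(X \<longlongrightarrow> l) G \<Longrightarrow> ((\<lambda>n. dual_energy f (X n)) \<longlongrightarrow> dual_energy f l) G"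
  unfolding dual_energy_def by (intro tendsto_intros)

text \<open>The linear part is exact at midpoints, so the whole gap comes from the squared norm;
  \<open>dual_energy_lower\<close> gives the ball of radius \<open>R\<close> that contains the
  sublevel set.\<close>

lemma dual_energy_midpoint_gap:
  assumes "uniformly_convex TYPE('a::real_normed_vector)" and "0 < \<epsilon>"
  obtains \<delta> where "0 < \<delta>"
    "\<And>u v :: 'a. \<lbrakk>dual_energy f u \<le> c; dual_energy f v \<le> c; \<epsilon> \<le> norm (u - v)\<rbrakk>
      \<Longrightarrow> dual_energy f ((u + v) /\<^sub>R 2) \<le> (dual_energy f u + dual_energy f v) / 2 - \<delta>"
proof -
  define R where "R = norm f + sqrt (c + (norm f)\<^sup>2)"
  obtain \<delta> where "0 < \<delta>" and \<delta>: "\<And>u v :: 'a. \<lbrakk>norm u \<le> R; norm v \<le> R; \<epsilon> \<le> norm (u - v)\<rbrakk>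
      \<Longrightarrow> (norm ((u + v) /\<^sub>R 2))\<^sup>2 \<le> ((norm u)\<^sup>2 + (norm v)\<^sup>2) / 2 - \<delta>"
    using uniformly_convex_norm_square[OF assms] by metis
  have R: "norm u \<le> R" if "dual_energy f u \<le> c" for u
  proof -
    have "(norm u - norm f)\<^sup>2 \<le> c + (norm f)\<^sup>2"
      using dual_energy_lower[of u f] that by linarith
    then have "norm u - norm f \<le> sqrt (c + (norm f)\<^sup>2)" by (rule real_le_rsqrt)
    then show ?thesis by (simp add: R_def)
  qed
  have "dual_energy f ((u + v) /\<^sub>R 2) \<le> (dual_energy f u + dual_energy f v) / 2 - \<delta>"
    if "dual_energy f u \<le> c" "dual_energy f v \<le> c" "\<epsilon> \<le> norm (u - v)" for u v
  proof -
    have "blinfun_apply f ((u + v) /\<^sub>R 2) = (blinfun_apply f u + blinfun_apply f v) / 2"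
      by (simp only: blinfun.scaleR_right blinfun.add_right) simp
    moreover have "(norm ((u + v) /\<^sub>R 2))\<^sup>2 \<le> ((norm u)\<^sup>2 + (norm v)\<^sup>2) / 2 - \<delta>"
      using that R by (intro \<delta>)
    ultimately show ?thesis
      unfolding dual_energy_def by argo
  qed
  with \<open>0 < \<delta>\<close> show ?thesis by (rule that)
qed

text \<open>The midpoint of two far-apart points would fall below the level \<open>c\<close>. The
  lower bound concerns only midpoints of late terms, so the lemma serves both a minimizing sequence
  in one set and projections onto shrinking sets.\<close>

lemma Cauchy_if_dual_energy:
  fixes X :: "nat \<Rightarrow> 'a::real_normed_vector"
  assumes uc: "uniformly_convex TYPE('a)"
    and upper: "\<And>e. 0 < e \<Longrightarrow> \<forall>\<^sub>F n in sequentially. dual_energy f (X n) \<le> c + e"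
    and lower: "\<And>e. 0 < e \<Longrightarrow>
      \<exists>M. \<forall>m\<ge>M. \<forall>n\<ge>M. c - e \<le> dual_energy f ((X m + X n) /\<^sub>R 2)"
  shows "Cauchy X"
proof (rule metric_CauchyI)
  fix \<epsilon> :: real assume "0 < \<epsilon>"
  then obtain \<delta> where "0 < \<delta>" and
    \<delta>: "\<And>u v. \<lbrakk>dual_energy f u \<le> c + 1; dual_energy f v \<le> c + 1; \<epsilon> \<le> norm (u - v)\<rbrakk>
      \<Longrightarrow> dual_energy f ((u + v) /\<^sub>R 2) \<le> (dual_energy f u + dual_energy f v) / 2 - \<delta>"
    using dual_energy_midpoint_gap[OF uc, of \<epsilon> f "c + 1"] by metis
  \<comment> \<open>Energies at most \<open>c + e\<close>, a midpoint at least \<open>c - e\<close>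
    and a gap \<open>\<delta>\<close> would force \<open>\<delta> \<le> 2 * e\<close>. The cap 1
    keeps the points in the sublevel set for which \<open>\<delta>\<close> was chosen.\<close>
  define e where "e = min 1 (\<delta> / 3)"
  have e: "0 < e" "e \<le> 1" "3 * e \<le> \<delta>" using \<open>0 < \<delta>\<close> by (auto simp: e_def)
  obtain M1 where M1: "\<And>n. M1 \<le> n \<Longrightarrow> dual_energy f (X n) \<le> c + e"
    using upper[OF e(1)] by (auto simp: eventually_sequentially)
  obtain M2 where M2: "\<And>m n. \<lbrakk>M2 \<le> m; M2 \<le> n\<rbrakk> \<Longrightarrow> c - e \<le> dual_energy f ((X m + X n) /\<^sub>R 2)"
    using lower[OF e(1)] by auto
  show "\<exists>M. \<forall>m\<ge>M. \<forall>n\<ge>M. dist (X m) (X n) < \<epsilon>"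
  proof (intro exI allI impI)
    fix m n assume mn: "max M1 M2 \<le> m" "max M1 M2 \<le> n"
    then have en: "dual_energy f (X m) \<le> c + e" "dual_energy f (X n) \<le> c + e"
      "c - e \<le> dual_energy f ((X m + X n) /\<^sub>R 2)"
      using M1 M2 by auto
    show "dist (X m) (X n) < \<epsilon>"
    proof (rule ccontr)
      assume "\<not> dist (X m) (X n) < \<epsilon>"
      then have "\<epsilon> \<le> norm (X m - X n)" by (simp add: dist_norm)
      then have "dual_energy f ((X m + X n) /\<^sub>R 2)
          \<le> (dual_energy f (X m) + dual_energy f (X n)) / 2 - \<delta>"
        using en e by (intro \<delta>) auto
      with en e show False by argo
    qed
  qed
qed

lemma convex_midpoint: "\<lbrakk>convex K; u \<in> K; v \<in> K\<rbrakk> \<Longrightarrow> (u + v) /\<^sub>R 2 \<in> K"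
  using convexD[of K u v "1/2" "1/2"] by (simp add: scaleR_add_right inverse_eq_divide)

text \<open>A minimizing sequence has its midpoints in \<open>K\<close>, where the energy is at
  least the infimum; hence it is Cauchy, and completeness gives the minimizer.\<close>

lemma dual_energy_minimizer_exists:
  fixes K :: "'a::banach set"
  assumes uc: "uniformly_convex TYPE('a)" and K: "K \<noteq> {}" "closed K" "convex K"
  obtains v where "v \<in> K" "\<And>u. u \<in> K \<Longrightarrow> dual_energy f v \<le> dual_energy f u"
proof -
  define c where "c = Inf (dual_energy f ` K)"
  have bdd: "bdd_below (dual_energy f ` K)"
    by (rule bdd_belowI2) (rule dual_energy_ge)
  then have c: "c \<le> dual_energy f u" if "u \<in> K" for u
    using that by (auto simp: c_def intro: cInf_lower)
  have "\<exists>u\<in>K. dual_energy f u < c + 1 / real (Suc n)" for n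
    using cInf_lessD[of "dual_energy f ` K" "c + 1 / real (Suc n)"] K(1) by (auto simp: c_def)
  then obtain X where X: "\<And>n. X n \<in> K" "\<And>n. dual_energy f (X n) < c + 1 / real (Suc n)"
    by metis
  have lim: "(\<lambda>n. c + 1 / real (Suc n)) \<longlonglongrightarrow> c"
    using tendsto_add[OF tendsto_const LIMSEQ_Suc[OF lim_inverse_n'], of c] by simp
  have "Cauchy X"
  proof (rule Cauchy_if_dual_energy[OF uc])
    fix e :: real assume "0 < e"
    then have "\<forall>\<^sub>F n in sequentially. c + 1 / real (Suc n) < c + e"
      using lim by (intro order_tendstoD) auto
    then show "\<forall>\<^sub>F n in sequentially. dual_energy f (X n) \<le> c + e"
      by eventually_elim (rule less_imp_le[OF order.strict_trans[OF X(2)]])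
    have "c - e \<le> dual_energy f ((X m + X n) /\<^sub>R 2)" for m n
      using c[OF convex_midpoint[OF K(3) X(1) X(1), of m n]] \<open>0 < e\<close> by linarith
    then show "\<exists>M. \<forall>m\<ge>M. \<forall>n\<ge>M. c - e \<le> dual_energy f ((X m + X n) /\<^sub>R 2)"
      by blast
  qed
  then obtain v where v: "X \<longlonglongrightarrow> v"
    by (auto simp: Cauchy_convergent_iff convergent_def)
  show ?thesis
  proof (rule that)
    show "v \<in> K" using K(2) X(1) v by (rule closed_sequentially)
    have "dual_energy f v \<le> c"
      using tendsto_dual_energy[OF v] lim by (rule LIMSEQ_le) (use X(2) less_imp_le in blast)
    then show "dual_energy f v \<le> dual_energy f u" if "u \<in> K" for u
      using c[OF that] by simp
  qed
qed

text \<open>The midpoint of two distinct minimizers would have strictly smaller energy.\<close>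

lemma dual_energy_minimizer_unique:
  assumes uc: "uniformly_convex TYPE('a::real_normed_vector)" and "convex K"
    and u: "u \<in> K" "\<And>w. w \<in> K \<Longrightarrow> dual_energy f u \<le> dual_energy f w"
    and v: "v \<in> K" "\<And>w. w \<in> K \<Longrightarrow> dual_energy f v \<le> dual_energy f w"
  shows "u = (v :: 'a)"
proof (rule ccontr)
  assume "u \<noteq> v"
  then have "0 < norm (u - v)" by simp
  then obtain \<delta> where "0 < \<delta>" "\<And>u' v'. \<lbrakk>dual_energy f u' \<le> dual_energy f u;
      dual_energy f v' \<le> dual_energy f u; norm (u - v) \<le> norm (u' - v')\<rbrakk>
      \<Longrightarrow> dual_energy f ((u' + v') /\<^sub>R 2) \<le> (dual_energy f u' + dual_energy f v') / 2 - \<delta>"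
    using dual_energy_midpoint_gap[OF uc, of "norm (u - v)" f "dual_energy f u"] by metis
  from this(1) this(2)[of u v] u(2)[OF v(1)] v(2)[OF u(1)]
    u(2)[OF convex_midpoint[OF \<open>convex K\<close> u(1) v(1)]]
  show False by auto
qed

section \<open>The duality map\<close>

text \<open>Smoothness speaks of unit directions; a general direction is reached by substituting
  \<open>t * norm v\<close> for \<open>t\<close>.\<close>

lemma norm_directional_derivative:
  fixes u v :: "'a::real_normed_vector"
  assumes us: "uniformly_smooth TYPE('a)" and u: "norm u = 1"
  shows "\<exists>l. ((\<lambda>t. (norm (u + t *\<^sub>R v) - 1) / t) \<longlongrightarrow> l) (at 0)"
proof (cases "v = 0")
  case True
  then show ?thesis using u by auto
next
  case False
  define w where "w = v /\<^sub>R norm v"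
  have w: "norm w = 1" "v = norm v *\<^sub>R w" using False by (auto simp: w_def)
  obtain d where d: "uniform_limit (sphere 0 1 \<times> sphere 0 1)
      (\<lambda>t (x :: 'a, y). (norm (x + t *\<^sub>R y) - norm x) / t) d (at 0)"
    using us by (auto simp: uniformly_smooth_def)
  have "((\<lambda>t. (norm (u + t *\<^sub>R w) - 1) / t) \<longlongrightarrow> d (u, w)) (at 0)"
    using tendsto_uniform_limitI[OF d, of "(u, w)"] u w by simp
  moreover have "filterlim (\<lambda>t. t * norm v) (at 0) (at 0)"
    using False by (intro filterlim_atI tendsto_eq_intros) (auto simp: eventually_at_filter)
  ultimately have "((\<lambda>t. (norm (u + (t * norm v) *\<^sub>R w) - 1) / (t * norm v)) \<longlongrightarrow> d (u, w)) (at 0)"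
    by (rule filterlim_compose)
  from tendsto_mult_left[OF this, of "norm v"]
  have "((\<lambda>t. norm v * ((norm (u + (t * norm v) *\<^sub>R w) - 1) / (t * norm v))) \<longlongrightarrow> norm v * d (u, w)) (at 0)" .
  moreover have "norm v * ((norm (u + (t * norm v) *\<^sub>R w) - 1) / (t * norm v))
      = (norm (u + t *\<^sub>R v) - 1) / t" for t
    using False w(2) by (metis (no_types, lifting) divide_divide_eq_right mult.commute
        nonzero_mult_div_cancel_right norm_eq_zero scaleR_scaleR times_divide_eq_right
        divide_divide_eq_left)
  ultimately show ?thesis by auto
qed

text \<open>The functional is the directional derivative of the norm at \<open>u\<close>. The
  two-sided limit gives homogeneity also for negative scalars, the triangle inequality gives
  subadditivity, and both together give additivity.\<close>

lemma norming_functional_exists: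
  fixes u :: "'a::real_normed_vector"
  assumes us: "uniformly_smooth TYPE('a)" and u: "norm u = 1"
  obtains f :: "'a \<Rightarrow>\<^sub>L real" where "blinfun_apply f u = 1" "norm f = 1"
    "\<And>v. ((\<lambda>t. (norm (u + t *\<^sub>R v) - 1) / t) \<longlongrightarrow> blinfun_apply f v) (at 0)"
proof -
  define q where "q = (\<lambda>v t. (norm (u + t *\<^sub>R v) - 1) / t)"
  obtain g where g: "\<And>v. (q v \<longlongrightarrow> g v) (at 0)"
    using norm_directional_derivative[OF us u] unfolding q_def by metis
  have scale_lim: "((\<lambda>t. q v (t * c)) \<longlongrightarrow> g v) (at 0)" if "c \<noteq> 0" for v c
  proof -
    have "filterlim (\<lambda>t. t * c) (at 0) (at 0)"
      using that by (intro filterlim_atI tendsto_eq_intros) (auto simp: eventually_at_filter)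
    with g show ?thesis by (rule filterlim_compose)
  qed
  have scale: "g (c *\<^sub>R v) = c * g v" for c v
  proof (cases "c = 0")
    case True
    have "q 0 = (\<lambda>_. 0)" using u by (auto simp: q_def)
    then have "g 0 = 0" using tendsto_unique[OF _ g[of 0], of 0] by simp
    with True show ?thesis by simp
  next
    case False
    have "q (c *\<^sub>R v) t = c * q v (t * c)" for t
      using False by (simp add: q_def)
    then have "(q (c *\<^sub>R v) \<longlongrightarrow> c * g v) (at 0)"
      using tendsto_mult_left[OF scale_lim[OF False], of c v] by presburger
    with g show ?thesis by (intro tendsto_unique) auto
  qed
  have sub: "g (v + w) \<le> g v + g w" for v w
  proof -
    \<comment> \<open>\<open>u + t *\<^sub>R (v + w)\<close> is the midpoint of
      \<open>u + (t * 2) *\<^sub>R v\<close> and \<open>u + (t * 2) *\<^sub>R w\<close>, hence the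
      doubled step. Division by \<open>t\<close> keeps the inequality only for positive
      \<open>t\<close>, so the limit is then taken from the right.\<close>
    have ev: "q (v + w) t \<le> q v (t * 2) + q w (t * 2)" if "0 < t" for t
    proof -
      have "2 *\<^sub>R (u + t *\<^sub>R (v + w)) = (u + (t * 2) *\<^sub>R v) + (u + (t * 2) *\<^sub>R w)"
        by (simp add: algebra_simps scaleR_2)
      then have "2 * norm (u + t *\<^sub>R (v + w)) \<le> norm (u + (t * 2) *\<^sub>R v) + norm (u + (t * 2) *\<^sub>R w)"
        by (metis norm_scaleR abs_numeral norm_triangle_ineq)
      then have "(2 * norm (u + t *\<^sub>R (v + w)) - 2) / (t * 2)
          \<le> (norm (u + (t * 2) *\<^sub>R v) + norm (u + (t * 2) *\<^sub>R w) - 2) / (t * 2)"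
        using that by (intro divide_right_mono) auto
      moreover have "q (v + w) t = (2 * norm (u + t *\<^sub>R (v + w)) - 2) / (t * 2)"
        using that by (simp add: q_def divide_simps)
      moreover have "q v (t * 2) + q w (t * 2)
          = (norm (u + (t * 2) *\<^sub>R v) + norm (u + (t * 2) *\<^sub>R w) - 2) / (t * 2)"
        by (simp add: q_def flip: add_divide_distrib)
      ultimately show ?thesis by simp
    qed
    have at: "at_right (0::real) \<le> at 0" by (rule at_le) simp
    show ?thesis
    proof (rule tendsto_le)
      show "at_right (0::real) \<noteq> bot" by simp
      show "((\<lambda>t. q v (t * 2) + q w (t * 2)) \<longlongrightarrow> g v + g w) (at_right 0)"
        by (intro tendsto_add tendsto_mono[OF at] scale_lim) auto
      show "(q (v + w) \<longlongrightarrow> g (v + w)) (at_right 0)"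
        by (rule tendsto_mono[OF at g])
      show "\<forall>\<^sub>F t in at_right 0. q (v + w) t \<le> q v (t * 2) + q w (t * 2)"
        using ev by (auto simp: eventually_at_right_field intro: exI[of _ 1])
    qed
  qed
  have neg: "g (- v) = - g v" for v
    using scale[of "-1" v] by simp
  \<comment> \<open>Subadditivity at \<open>- v\<close> and \<open>- w\<close> is the reverse
    inequality.\<close>
  have add: "g (v + w) = g v + g w" for v w
    using sub[of v w] sub[of "- v" "- w"] neg[of v] neg[of w] neg[of "v + w"] by simp
  have bound: "\<bar>g v\<bar> \<le> norm v" for v
  proof -
    have "\<bar>q v t\<bar> \<le> norm v" if "t \<noteq> 0" for t
      using that norm_triangle_ineq3[of "u + t *\<^sub>R v" u] u
      by (simp add: q_def abs_divide pos_divide_le_eq mult.commute)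
    then have "\<forall>\<^sub>F t in at 0. \<bar>q v t\<bar> \<le> norm v" by (auto simp: eventually_at_filter)
    then show ?thesis
      by (intro tendsto_upperbound[OF tendsto_rabs[OF g]]) auto
  qed
  have bl: "bounded_linear g"
    by (rule bounded_linear_intro[where K = 1]) (use add scale bound in auto)
  \<comment> \<open>Along \<open>u\<close> itself the norm is \<open>1 + t\<close> as long as
    \<open>\<bar>t\<bar> < 1\<close>.\<close>
  have "\<forall>\<^sub>F t in at 0. q u t = 1"
  proof -
    have "q u t = 1" if "\<bar>t\<bar> < 1" "t \<noteq> 0" for t
    proof -
      have "u + t *\<^sub>R u = (1 + t) *\<^sub>R u" by (simp add: algebra_simps)
      with that u show ?thesis by (simp add: q_def)
    qed
    then show ?thesis by (auto simp: eventually_at dist_real_def intro: exI[of _ 1])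
  qed
  then have "(q u \<longlongrightarrow> 1) (at 0)" by (rule tendsto_eventually)
  with g have gu: "g u = 1" by (intro tendsto_unique) auto
  show ?thesis
  proof (rule that)
    show fu: "blinfun_apply (Blinfun g) u = 1"
      using gu bl by (simp add: bounded_linear_Blinfun_apply)
    have "norm (Blinfun g) \<le> 1"
      by (rule norm_blinfun_bound) (use bound bl in \<open>auto simp: bounded_linear_Blinfun_apply\<close>)
    then show "norm (Blinfun g) = 1"
      using blinfun_le_norm[of "Blinfun g" u] fu u by simp
    show "((\<lambda>t. (norm (u + t *\<^sub>R v) - 1) / t) \<longlongrightarrow> blinfun_apply (Blinfun g) v) (at 0)" for v
      using g[of v] bl by (simp add: bounded_linear_Blinfun_apply q_def)
  qed
qed

text \<open>As \<open>g\<close> has norm 1 and \<open>g u = 1\<close>, for \<open>t > 0\<close> the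
  difference quotient bounds \<open>g v\<close> from above. So \<open>g\<close> lies below
  \<open>f\<close>, and passing to \<open>- v\<close> gives equality.\<close>

lemma norming_functional_unique:
  fixes u :: "'a::real_normed_vector" and f g :: "'a \<Rightarrow>\<^sub>L real"
  assumes u: "norm u = 1" and g: "blinfun_apply g u = 1" "norm g = 1"
    and f: "\<And>v. ((\<lambda>t. (norm (u + t *\<^sub>R v) - 1) / t) \<longlongrightarrow> blinfun_apply f v) (at 0)"
  shows "g = f"
proof (rule blinfun_eqI)
  have le: "blinfun_apply g v \<le> blinfun_apply f v" for v
  proof -
    have "blinfun_apply g v \<le> (norm (u + t *\<^sub>R v) - 1) / t" if "0 < t" for t
      using blinfun_le_norm[of g "u + t *\<^sub>R v"] g that
      by (simp add: blinfun.add_right blinfun.scaleR_right pos_le_divide_eq mult.commute)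
    then have "\<forall>\<^sub>F t in at_right 0. blinfun_apply g v \<le> (norm (u + t *\<^sub>R v) - 1) / t"
      by (auto simp: eventually_at_right_field intro: exI[of _ 1])
    moreover have "((\<lambda>t. (norm (u + t *\<^sub>R v) - 1) / t) \<longlongrightarrow> blinfun_apply f v) (at_right 0)"
      by (rule tendsto_mono[OF at_le f]) simp
    ultimately show ?thesis by (intro tendsto_lowerbound) auto
  qed
  show "blinfun_apply g v = blinfun_apply f v" for v
    using le[of v] le[of "- v"] by (simp add: blinfun.minus_right)
qed

text \<open>This gives the \<open>THE\<close> in \<open>duality_map\<close> its meaning. For nonzero
  \<open>x\<close>, existence and uniqueness are both scaled from the unit vector
  \<open>u\<close>.\<close>

lemma duality_functional_ex1:
  fixes x :: "'a::real_normed_vector"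
  assumes us: "uniformly_smooth TYPE('a)"
  shows "\<exists>!f. blinfun_apply f x = (norm x)\<^sup>2 \<and> (norm f)\<^sup>2 = (norm x)\<^sup>2"
proof (cases "x = 0")
  case True
  then show ?thesis by (intro ex1I[of _ 0]) auto
next
  case False
  define r where "r = norm x"
  define u where "u = x /\<^sub>R r"
  have r: "0 < r" and u: "norm u = 1" and x: "x = r *\<^sub>R u"
    using False by (auto simp: r_def u_def)
  obtain f :: "'a \<Rightarrow>\<^sub>L real" where f: "blinfun_apply f u = 1" "norm f = 1"
    "\<And>v. ((\<lambda>t. (norm (u + t *\<^sub>R v) - 1) / t) \<longlongrightarrow> blinfun_apply f v) (at 0)"
    using norming_functional_exists[OF us u] by metis
  show ?thesis
  proof (rule ex1I)
    show "blinfun_apply (r *\<^sub>R f) x = (norm x)\<^sup>2 \<and> (norm (r *\<^sub>R f))\<^sup>2 = (norm x)\<^sup>2"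
      using f r u by (simp add: x blinfun.scaleR_right blinfun.scaleR_left power2_eq_square)
  next
    fix g assume g: "blinfun_apply g x = (norm x)\<^sup>2 \<and> (norm g)\<^sup>2 = (norm x)\<^sup>2"
    then have "norm g = r" by (simp add: r_def)
    moreover have "blinfun_apply g x = r\<^sup>2" using g by (simp add: r_def)
    then have "r * blinfun_apply g u = r * r"
      by (simp add: x blinfun.scaleR_right power2_eq_square)
    ultimately have "g /\<^sub>R r = f"
      using r by (intro norming_functional_unique[OF u _ _ f(3)])
        (auto simp: blinfun.scaleR_left)
    with r show "g = r *\<^sub>R f" by auto
  qed
qed

lemma duality_map:
  fixes x :: "'a::real_normed_vector"
  assumes us: "uniformly_smooth TYPE('a)"
  shows duality_map_apply_self: "blinfun_apply (duality_map x) x = (norm x)\<^sup>2"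
    and norm_duality_map: "norm (duality_map x) = norm x"
  using theI'[OF duality_functional_ex1[OF us, of x]] unfolding duality_map_def by auto

lemma duality_map_eqI:
  assumes "uniformly_smooth TYPE('a::real_normed_vector)"
    and "blinfun_apply f x = (norm x)\<^sup>2" "norm f = norm (x :: 'a)"
  shows "duality_map x = f"
  unfolding duality_map_def by (rule the1_equality[OF duality_functional_ex1]) (use assms in auto)

text \<open>A minimizer \<open>w\<close> of \<open>v \<mapsto> \<parallel>v\<parallel>\<^sup>2 - 2 f v\<close> over the whole space is a preimage of \<open>f\<close>: optimizing
  over the multiples of each \<open>v\<close> shows that the minimum is at most \<open>-\<parallel>f\<parallel>\<^sup>2\<close>.\<close>

lemma surj_duality_map:
  assumes us: "uniformly_smooth TYPE('a::banach)" and uc: "uniformly_convex TYPE('a)"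
  shows "surj (duality_map :: 'a \<Rightarrow> _)"
proof (unfold surj_def, rule allI)
  fix f :: "'a \<Rightarrow>\<^sub>L real"
  obtain w where w: "\<And>v. dual_energy f w \<le> dual_energy f v"
    using dual_energy_minimizer_exists[OF uc, of UNIV f] by auto
  define m where "m = - dual_energy f w"
  have "0 \<le> m" using w[of 0] by (simp add: m_def dual_energy_def)
  have "\<bar>blinfun_apply f v\<bar> \<le> sqrt m * norm v" for v
  proof (cases "v = 0")
    case False
    define s where "s = blinfun_apply f v / (norm v)\<^sup>2"
    have "dual_energy f (s *\<^sub>R v) = - ((blinfun_apply f v)\<^sup>2 / (norm v)\<^sup>2)"
      using False by (simp add: dual_energy_def s_def blinfun.scaleR_right power_mult_distrib
          power_divide power2_eq_square field_simps)
    then have "(blinfun_apply f v)\<^sup>2 / (norm v)\<^sup>2 \<le> m"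
      using w[of "s *\<^sub>R v"] by (simp add: m_def)
    then have "(blinfun_apply f v)\<^sup>2 \<le> m * (norm v)\<^sup>2"
      using False by (simp add: pos_divide_le_eq)
    then have "sqrt ((blinfun_apply f v)\<^sup>2) \<le> sqrt (m * (norm v)\<^sup>2)"
      by (rule real_sqrt_le_mono)
    then show ?thesis by (simp add: real_sqrt_mult)
  qed simp
  then have "norm f \<le> sqrt m"
    using \<open>0 \<le> m\<close> by (intro norm_blinfun_bound) auto
  then have fm: "(norm f)\<^sup>2 \<le> m"
    using \<open>0 \<le> m\<close> by (metis norm_ge_zero power_mono real_sqrt_pow2)
  \<comment> \<open>With the norm of \<open>f\<close> squared at most \<open>m\<close>, the lower
    bound on the energy at \<open>w\<close> leaves no room for a nonzero square, so \<open>w\<close>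
    and \<open>f\<close> have equal norms.\<close>
  then have sq: "(norm w - norm f)\<^sup>2 \<le> 0" "m \<le> (norm f)\<^sup>2"
    using dual_energy_lower[of w f] dual_energy_ge[of f w] unfolding m_def by linarith+
  then have nw: "norm f = norm w" by simp
  moreover have "blinfun_apply f w = (norm w)\<^sup>2"
    using sq(2) fm nw by (simp add: m_def dual_energy_def)
  ultimately have "duality_map w = f" using us by (intro duality_map_eqI)
  then show "\<exists>w. f = duality_map w" by metis
qed

section \<open>The Lyapunov functional and generalized projections\<close>

lemma lyapunov_eq_dual_energy: "lyapunov v x = dual_energy (duality_map x) v + (norm x)\<^sup>2"
  by (simp add: lyapunov_def dual_energy_def)

lemma is_arg_min_lyapunov_iff:
  "is_arg_min (\<lambda>v. lyapunov v x) (\<lambda>v. v \<in> K) w \<longleftrightarrow>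
     w \<in> K \<and> (\<forall>u\<in>K. dual_energy (duality_map x) w \<le> dual_energy (duality_map x) u)"
  by (auto simp: is_arg_min_def lyapunov_eq_dual_energy not_less)

text \<open>\<open>arg_min_on\<close> is a Hilbert choice among minimizers; uniqueness of the
  minimizer determines its value.\<close>

lemma gen_proj_eqI:
  fixes K :: "'a::real_normed_vector set"
  assumes uc: "uniformly_convex TYPE('a)" and K: "convex K"
    and w: "w \<in> K" "\<And>u. u \<in> K \<Longrightarrow> lyapunov w x \<le> lyapunov u x"
  shows "gen_proj K x = w"
proof -
  have w': "is_arg_min (\<lambda>v. lyapunov v x) (\<lambda>v. v \<in> K) w"
    unfolding is_arg_min_lyapunov_iff using w by (simp add: lyapunov_eq_dual_energy)
  then have "is_arg_min (\<lambda>v. lyapunov v x) (\<lambda>v. v \<in> K) (gen_proj K x)"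
    unfolding gen_proj_def arg_min_on_def arg_min_def by (rule someI)
  with w' show ?thesis
    unfolding is_arg_min_lyapunov_iff by (intro dual_energy_minimizer_unique[OF uc K]) auto
qed

lemma gen_proj:
  fixes K :: "'a::banach set"
  assumes uc: "uniformly_convex TYPE('a)" and K: "K \<noteq> {}" "closed K" "convex K"
  shows gen_proj_in: "gen_proj K x \<in> K"
    and gen_proj_le: "u \<in> K \<Longrightarrow> lyapunov (gen_proj K x) x \<le> lyapunov u x"
proof -
  obtain w where w: "w \<in> K" "\<And>u. u \<in> K \<Longrightarrow> lyapunov w x \<le> lyapunov u x"
    using dual_energy_minimizer_exists[OF uc K, of "duality_map x"]
    by (auto simp: lyapunov_eq_dual_energy)
  then have "gen_proj K x = w" by (rule gen_proj_eqI[OF uc K(3)])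
  with w show "gen_proj K x \<in> K" "u \<in> K \<Longrightarrow> lyapunov (gen_proj K x) x \<le> lyapunov u x"
    by auto
qed

lemma tendsto_lyapunov_left: "(X \<longlongrightarrow> z) G \<Longrightarrow> ((\<lambda>n. lyapunov (X n) y) \<longlongrightarrow> lyapunov z y) G"
  unfolding lyapunov_eq_dual_energy by (intro tendsto_intros)

context
  fixes ty :: "'a::banach itself"
  assumes us: "uniformly_smooth TYPE('a)" and uc: "uniformly_convex TYPE('a)"
begin

lemma lyapunov_ge: "(norm z - norm w)\<^sup>2 \<le> lyapunov z w" for z w :: 'a
  using dual_energy_lower[of z "duality_map w"]
  by (simp add: lyapunov_eq_dual_energy norm_duality_map[OF us])

lemma lyapunov_nonneg: "0 \<le> lyapunov z w" for z w :: 'a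
  using lyapunov_ge[of z w] zero_le_power2[of "norm z - norm w"] by linarith

lemma lyapunov_self: "lyapunov z z = 0" for z :: 'a
  by (simp add: lyapunov_def duality_map_apply_self[OF us])

lemma lyapunov_le: "lyapunov z w \<le> (norm z + norm w)\<^sup>2" for z w :: 'a
  using blinfun_le_norm[of "duality_map w" "- z"]
  by (simp add: lyapunov_def norm_duality_map[OF us] power2_sum blinfun.minus_right algebra_simps)

text \<open>Writing \<open>z\<close> as \<open>W n - (W n - z)\<close> in the pairing with
  \<open>duality_map (W n)\<close> leaves a bound in terms of norms alone.\<close>

lemma lyapunov_tendsto_0:
  fixes z :: 'a
  assumes "(W \<longlongrightarrow> z) G"
  shows "((\<lambda>n. lyapunov z (W n)) \<longlongrightarrow> 0) G"
proof (rule tendsto_sandwich[OF always_eventually always_eventually tendsto_const])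
  show "\<forall>n. 0 \<le> lyapunov z (W n)" by (simp add: lyapunov_nonneg)
  show "\<forall>n. lyapunov z (W n) \<le> (norm z)\<^sup>2 - (norm (W n))\<^sup>2 + 2 * (norm (W n) * norm (W n - z))"
  proof
    fix n
    have "blinfun_apply (duality_map (W n)) (W n - z) \<le> norm (W n) * norm (W n - z)"
      using blinfun_le_norm[of "duality_map (W n)"] by (simp add: norm_duality_map[OF us])
    then show "lyapunov z (W n) \<le> (norm z)\<^sup>2 - (norm (W n))\<^sup>2 + 2 * (norm (W n) * norm (W n - z))"
      by (simp add: lyapunov_def blinfun.diff_right duality_map_apply_self[OF us])
  qed
  show "((\<lambda>n. (norm z)\<^sup>2 - (norm (W n))\<^sup>2 + 2 * (norm (W n) * norm (W n - z))) \<longlongrightarrow> 0) G"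
    by (rule tendsto_eq_intros assms | simp)+
qed

text \<open>Let \<open>m\<close> be the midpoint of \<open>W n\<close> and \<open>z\<close>.
  Nonnegativity of \<open>lyapunov m (W n)\<close> bounds the pairing with \<open>z\<close> by
  \<open>(norm m)\<^sup>2\<close>, so the convexity gap would give
  \<open>lyapunov z (W n) \<ge> 2 * \<delta>\<close> if \<open>W n\<close> stayed away from
  \<open>z\<close>.\<close>

lemma lyapunov_tendsto_0_imp:
  fixes z :: 'a
  assumes lim: "((\<lambda>n. lyapunov z (W n)) \<longlongrightarrow> 0) G"
  shows "(W \<longlongrightarrow> z) G"
proof (rule tendstoI)
  fix \<epsilon> :: real assume "0 < \<epsilon>"
  then obtain \<delta> where "0 < \<delta>" and
    \<delta>: "\<And>u v :: 'a. \<lbrakk>norm u \<le> norm z + 1; norm v \<le> norm z + 1; \<epsilon> \<le> norm (u - v)\<rbrakk>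
      \<Longrightarrow> (norm ((u + v) /\<^sub>R 2))\<^sup>2 \<le> ((norm u)\<^sup>2 + (norm v)\<^sup>2) / 2 - \<delta>"
    using uniformly_convex_norm_square[OF uc, of \<epsilon> "norm z + 1"] by metis
  \<comment> \<open>The 1 confines \<open>W n\<close> to the ball of radius
    \<open>norm z + 1\<close> for which \<open>\<delta>\<close> was chosen.\<close>
  have "\<forall>\<^sub>F n in G. lyapunov z (W n) < min 1 \<delta>"
    using lim \<open>0 < \<delta>\<close> by (intro order_tendstoD) auto
  then show "\<forall>\<^sub>F n in G. dist (W n) z < \<epsilon>"
  proof eventually_elim
    case (elim n)
    let ?w = "W n" and ?j = "blinfun_apply (duality_map (W n))"
    have "(norm z - norm ?w)\<^sup>2 \<le> 1"
      using lyapunov_ge[of z ?w] elim by simp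
    then have w: "norm ?w \<le> norm z + 1"
      by (simp add: abs_square_le_1)
    show ?case
    proof (rule ccontr)
      assume "\<not> dist ?w z < \<epsilon>"
      then have "\<epsilon> \<le> norm (?w - z)" by (simp add: dist_norm)
      with w have "(norm ((?w + z) /\<^sub>R 2))\<^sup>2 \<le> ((norm ?w)\<^sup>2 + (norm z)\<^sup>2) / 2 - \<delta>"
        by (intro \<delta>) auto
      moreover have "?j ((?w + z) /\<^sub>R 2) = ((norm ?w)\<^sup>2 + ?j z) / 2"
        by (simp only: blinfun.scaleR_right blinfun.add_right duality_map_apply_self[OF us]) simp
      then have "?j z \<le> (norm ((?w + z) /\<^sub>R 2))\<^sup>2"
        using lyapunov_nonneg[of "(?w + z) /\<^sub>R 2" ?w] by (simp only: lyapunov_def) argo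
      ultimately have "2 * \<delta> \<le> lyapunov z ?w"
        by (simp only: lyapunov_def) argo
      with elim \<open>0 < \<delta>\<close> show False by simp
    qed
  qed
qed

text \<open>The duality map preserves norms and the pairing is linear in the functional, so this is
  convexity of the squared norm in the dual space.\<close>

lemma lyapunov_dual_convex:
  fixes p u v w :: 'a
  assumes w: "duality_map w = a *\<^sub>R duality_map u + (1 - a) *\<^sub>R duality_map v" and a: "0 \<le> a" "a \<le> 1"
  shows "lyapunov p w \<le> a * lyapunov p u + (1 - a) * lyapunov p v"
proof -
  have "norm w = norm (a *\<^sub>R duality_map u + (1 - a) *\<^sub>R duality_map v)"
    by (simp add: norm_duality_map[OF us] flip: w)
  also have "\<dots> \<le> a * norm u + (1 - a) * norm v"
    using a by (intro order.trans[OF norm_triangle_ineq]) (simp add: norm_duality_map[OF us])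
  finally have "(norm w)\<^sup>2 \<le> (a * norm u + (1 - a) * norm v)\<^sup>2"
    by (simp add: power_mono)
  also have "\<dots> = a * (norm u)\<^sup>2 + (1 - a) * (norm v)\<^sup>2 - a * (1 - a) * (norm u - norm v)\<^sup>2"
    by (simp add: power2_eq_square algebra_simps)
  also have "\<dots> \<le> a * (norm u)\<^sup>2 + (1 - a) * (norm v)\<^sup>2"
    using a by simp
  finally have "(norm w)\<^sup>2 \<le> a * (norm u)\<^sup>2 + (1 - a) * (norm v)\<^sup>2" .
  moreover have "blinfun_apply (duality_map w) p
      = a * blinfun_apply (duality_map u) p + (1 - a) * blinfun_apply (duality_map v) p"
    by (simp add: w blinfun.add_left blinfun.scaleR_left)
  ultimately show ?thesis
    by (simp add: lyapunov_def algebra_simps)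
qed

text \<open>The duality images of \<open>W n\<close> and \<open>Y n\<close> differ by
  \<open>\<alpha> n\<close> times a bounded quantity. Hence their norms and their pairings with
  \<open>z\<close> agree asymptotically, which carries the limit 0 of
  \<open>lyapunov z (Y n)\<close> over to \<open>W\<close>.\<close>

lemma tendsto_duality_perturbation:
  fixes z x0 :: 'a
  assumes Y: "Y \<longlonglongrightarrow> z" and \<alpha>: "\<alpha> \<longlonglongrightarrow> 0" and W: "Bseq W"
    and J: "\<And>n. duality_map (Y n) = \<alpha> n *\<^sub>R duality_map x0 + (1 - \<alpha> n) *\<^sub>R duality_map (W n)"
  shows "W \<longlonglongrightarrow> z"
proof -
  have "Bseq (\<lambda>n. duality_map (W n) - duality_map x0)"
  proof -
    obtain B where B: "\<And>n. norm (W n) \<le> B" using W by (auto simp: Bseq_def)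
    have "norm (duality_map (W n) - duality_map x0) \<le> B + norm x0" for n
      using norm_triangle_ineq4[of "duality_map (W n)" "duality_map x0"] B[of n]
      by (simp add: norm_duality_map[OF us])
    then show ?thesis by (rule BseqI')
  qed
  moreover have "\<alpha> n *\<^sub>R (duality_map (W n) - duality_map x0) = duality_map (W n) - duality_map (Y n)" for n
    by (simp add: J algebra_simps)
  ultimately have diff: "(\<lambda>n. duality_map (W n) - duality_map (Y n)) \<longlonglongrightarrow> 0"
    using bounded_bilinear.Zfun_prod_Bfun[OF bounded_bilinear_scaleR, of \<alpha> sequentially
        "\<lambda>n. duality_map (W n) - duality_map x0"] \<alpha>
    by (simp add: tendsto_Zfun_iff)
  have "(\<lambda>n. norm (W n) - norm (Y n)) \<longlonglongrightarrow> 0"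
  proof (rule Lim_null_comparison[OF always_eventually])
    show "\<forall>n. norm (norm (W n) - norm (Y n)) \<le> norm (duality_map (W n) - duality_map (Y n))"
      using norm_triangle_ineq3[of "duality_map (W _)" "duality_map (Y _)"]
      by (simp add: norm_duality_map[OF us])
    show "(\<lambda>n. norm (duality_map (W n) - duality_map (Y n))) \<longlonglongrightarrow> 0"
      using tendsto_norm[OF diff] by simp
  qed
  moreover have nY: "(\<lambda>n. norm (Y n)) \<longlonglongrightarrow> norm z" using Y by (rule tendsto_norm)
  ultimately have nW: "(\<lambda>n. norm (W n)) \<longlonglongrightarrow> norm z"
    using tendsto_add[of "\<lambda>n. norm (W n) - norm (Y n)" 0 sequentially "\<lambda>n. norm (Y n)" "norm z"] by simp
  have "(\<lambda>n. lyapunov z (Y n) - 2 * blinfun_apply (duality_map (W n) - duality_map (Y n)) z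
      + ((norm (W n))\<^sup>2 - (norm (Y n))\<^sup>2)) \<longlonglongrightarrow> 0"
    by (rule tendsto_eq_intros blinfun.tendsto diff nW nY lyapunov_tendsto_0[OF Y] tendsto_const | simp)+
  then have "(\<lambda>n. lyapunov z (W n)) \<longlonglongrightarrow> 0"
    by (simp add: lyapunov_def blinfun.diff_left algebra_simps)
  then show ?thesis by (rule lyapunov_tendsto_0_imp)
qed

section \<open>Fixed point sets and shrinking projections\<close>

lemma fixed_point_if_iterates_tendsto:
  fixes T :: "'a \<Rightarrow> 'a"
  assumes T: "T \<in> C \<rightarrow> C" "continuous_on C T" and z: "z \<in> C" "(\<lambda>n. (T ^^ n) z) \<longlonglongrightarrow> z"
  shows "z \<in> fixed_points C T"
proof -
  have "(T ^^ n) z \<in> C" for n by (induction n) (use T z in auto)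
  then have "(\<lambda>n. T ((T ^^ n) z)) \<longlonglongrightarrow> T z"
    using T(2) z by (simp add: continuous_on_sequentially o_def)
  moreover have "(\<lambda>n. T ((T ^^ n) z)) \<longlonglongrightarrow> z"
    using LIMSEQ_Suc[OF z(2)] by simp
  ultimately show ?thesis using z LIMSEQ_unique by (fastforce simp: fixed_points_def)
qed

text \<open>For a convex combination \<open>z\<close> of \<open>p\<close> and \<open>q\<close>,
  \<open>lyapunov z w\<close> is the same combination of \<open>lyapunov p w\<close> and
  \<open>lyapunov q w\<close> plus a term independent of \<open>w\<close>. Comparing
  \<open>w = z\<close> with the iterates of \<open>z\<close> shows that they tend to
  \<open>z\<close>.\<close>

lemma convex_fixed_points:
  fixes T :: "'a \<Rightarrow> 'a"
  assumes C: "convex C" and T: "T \<in> C \<rightarrow> C" "continuous_on C T"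
    and asymp: "asymp_quasi_phi_nonexpansive C k T"
  shows "convex (fixed_points C T)"
proof (rule convexI)
  fix p q :: 'a and s t :: real
  assume p: "p \<in> fixed_points C T" and q: "q \<in> fixed_points C T"
    and st: "0 \<le> s" "0 \<le> t" "s + t = 1"
  let ?z = "s *\<^sub>R p + t *\<^sub>R q"
  have z: "?z \<in> C" using C p q st by (auto simp: fixed_points_def intro: convexD)
  have k: "k \<longlonglongrightarrow> 1" and step: "\<And>n r. \<lbrakk>1 \<le> n; r \<in> fixed_points C T\<rbrakk>
      \<Longrightarrow> lyapunov r ((T ^^ n) ?z) \<le> k n * lyapunov r ?z"
    using asymp z by (auto simp: asymp_quasi_phi_nonexpansive_def)
  have comb: "lyapunov ?z w = s * lyapunov p w + t * lyapunov q w
      + ((norm ?z)\<^sup>2 - s * (norm p)\<^sup>2 - t * (norm q)\<^sup>2)" for w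
  proof -
    have "(norm w)\<^sup>2 = s * (norm w)\<^sup>2 + t * (norm w)\<^sup>2"
      using st by (simp flip: distrib_right)
    then show ?thesis
      by (simp add: lyapunov_def blinfun.add_right blinfun.scaleR_right algebra_simps)
  qed
  \<comment> \<open>Because \<open>lyapunov ?z ?z = 0\<close>, the term independent of
    \<open>w\<close> in \<open>comb\<close> equals \<open>- S\<close>.\<close>
  define S where "S = s * lyapunov p ?z + t * lyapunov q ?z"
  have "(\<lambda>n. lyapunov ?z ((T ^^ n) ?z)) \<longlonglongrightarrow> 0"
  proof (rule tendsto_sandwich[OF always_eventually _ tendsto_const])
    show "\<forall>n. 0 \<le> lyapunov ?z ((T ^^ n) ?z)" by (simp add: lyapunov_nonneg)
    have "lyapunov ?z ((T ^^ n) ?z) \<le> (k n - 1) * S" if "1 \<le> n" for n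
    proof -
      have "s * lyapunov p ((T ^^ n) ?z) + t * lyapunov q ((T ^^ n) ?z)
          \<le> s * (k n * lyapunov p ?z) + t * (k n * lyapunov q ?z)"
        using step[OF that p] step[OF that q] st by (intro add_mono mult_left_mono)
      also have "\<dots> = k n * S" by (simp add: S_def algebra_simps)
      finally show ?thesis
        using comb[of "(T ^^ n) ?z"] comb[of ?z] lyapunov_self[of ?z] S_def
        by (simp add: algebra_simps)
    qed
    then show "\<forall>\<^sub>F n in sequentially. lyapunov ?z ((T ^^ n) ?z) \<le> (k n - 1) * S"
      by (auto simp: eventually_sequentially)
    show "(\<lambda>n. (k n - 1) * S) \<longlonglongrightarrow> 0"
      by (rule tendsto_eq_intros k | simp)+
  qed
  then have "(\<lambda>n. (T ^^ n) ?z) \<longlonglongrightarrow> ?z" by (rule lyapunov_tendsto_0_imp)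
  with T z show "?z \<in> fixed_points C T" by (intro fixed_point_if_iterates_tendsto)
qed

text \<open>The energies of \<open>X n\<close> never decrease and are bounded by that of
  \<open>p\<close>. For \<open>m\<close> and \<open>n\<close> beyond \<open>M\<close>, the midpoint
  of \<open>X m\<close> and \<open>X n\<close> lies in \<open>D M\<close>, so its energy is at least
  that of \<open>X M\<close>, which is close to the limit.\<close>

lemma gen_proj_decreasing_convergent:
  fixes D :: "nat \<Rightarrow> 'a set"
  assumes D: "\<And>n. closed (D n)" "\<And>n. convex (D n)" "decseq D" and p: "\<And>n. p \<in> D n"
    and X: "\<And>n. X n = gen_proj (D n) x0"
  shows "convergent X"
proof -
  let ?g = "dual_energy (duality_map x0)"
  have ne: "D n \<noteq> {}" for n using p by auto
  have XD: "X n \<in> D n" for n unfolding X by (rule gen_proj_in[OF uc ne D(1,2)])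
  have le: "?g (X n) \<le> ?g u" if "u \<in> D n" for n u
    using gen_proj_le[OF uc ne D(1,2) that] by (simp add: X lyapunov_eq_dual_energy)
  have "incseq (\<lambda>n. ?g (X n))"
    using XD D(3) by (intro incseq_SucI le) (auto simp: decseq_Suc_iff)
  moreover have "\<And>n. ?g (X n) \<le> ?g p" using le p by blast
  ultimately obtain c where c: "(\<lambda>n. ?g (X n)) \<longlonglongrightarrow> c" "\<And>n. ?g (X n) \<le> c"
    using incseq_convergent by metis
  have "Cauchy X"
  proof (rule Cauchy_if_dual_energy[OF uc])
    fix e :: real assume "0 < e"
    with c(2) show "\<forall>\<^sub>F n in sequentially. ?g (X n) \<le> c + e"
      by (intro always_eventually) (auto intro: add_increasing2)
    obtain M where M: "c - e \<le> ?g (X M)"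
      using order_tendstoD(1)[OF c(1), of "c - e"] \<open>0 < e\<close>
      by (auto simp: eventually_sequentially intro: less_imp_le)
    have "c - e \<le> ?g ((X m + X n) /\<^sub>R 2)" if "M \<le> m" "M \<le> n" for m n
    proof -
      have "X m \<in> D M" "X n \<in> D M"
        using XD decseqD[OF D(3)] that by blast+
      then have "(X m + X n) /\<^sub>R 2 \<in> D M" by (intro convex_midpoint D(2))
      with M le show ?thesis by (blast intro: order.trans)
    qed
    then show "\<exists>M. \<forall>m\<ge>M. \<forall>n\<ge>M. c - e \<le> ?g ((X m + X n) /\<^sub>R 2)" by blast
  qed
  then show ?thesis by (simp add: Cauchy_convergent_iff)
qed

end

text \<open>The terms \<open>\<parallel>v\<parallel>\<^sup>2\<close> cancel, so the condition defining the sets \<open>C\<^sub>n\<close> cuts out a half-space.\<close>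

lemma lyapunov_half_space:
  fixes u v w :: "'a::real_normed_vector"
  obtains h :: "'a \<Rightarrow>\<^sub>L real" and b where
    "{v. lyapunov v y \<le> a * lyapunov v u + (1 - a) * lyapunov v w + e} = {v. blinfun_apply h v \<le> b}"
proof
  let ?h = "2 *\<^sub>R (a *\<^sub>R duality_map u + (1 - a) *\<^sub>R duality_map w - duality_map y)"
  let ?b = "a * (norm u)\<^sup>2 + (1 - a) * (norm w)\<^sup>2 + e - (norm y)\<^sup>2"
  show "{v. lyapunov v y \<le> a * lyapunov v u + (1 - a) * lyapunov v w + e}
      = {v. blinfun_apply ?h v \<le> ?b}"
    by (simp add: lyapunov_def blinfun.scaleR_left blinfun.add_left blinfun.diff_left algebra_simps)
qed

lemma convex_blinfun_le: "convex {v. blinfun_apply h v \<le> b}" for b :: real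
proof -
  have "{v. blinfun_apply h v \<le> b} = blinfun_apply h -` {..b}" by auto
  then show ?thesis
    by (simp add: convex_linear_vimage[OF bounded_linear.linear[OF blinfun.bounded_linear_right]])
qed

lemma closed_blinfun_le: "closed {v. blinfun_apply h v \<le> b}" for b :: real
  by (intro closed_Collect_le continuous_intros)

theorem theorem2:
  fixes C :: "'a::banach set"
    and N :: nat
    and T :: "nat \<Rightarrow> 'a \<Rightarrow> 'a"
    and k \<alpha> \<epsilon> L :: "nat \<Rightarrow> real"
    and \<omega> :: real
    and F :: "'a set"
    and x :: "nat \<Rightarrow> 'a"
    and y :: "nat \<Rightarrow> nat \<Rightarrow> 'a"
    and ind :: "nat \<Rightarrow> nat"
    and D :: "nat \<Rightarrow> 'a set"
  assumes "uniformly_smooth TYPE('a)"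
    and "uniformly_convex TYPE('a)"
    and "C \<noteq> {}" and "closed C" and "convex C"
    and "N \<ge> 1"
    and "\<And>i. i \<in> {1..N} \<Longrightarrow> T i \<in> C \<rightarrow> C"
    and "\<And>i. i \<in> {1..N} \<Longrightarrow> asymp_quasi_phi_nonexpansive C k (T i)"
    and "\<And>i. i \<in> {1..N} \<Longrightarrow> uniformly_lipschitz C (L i) (T i)"
    and "F = (\<Inter>i\<in>{1..N}. fixed_points C (T i))"
    and "F \<noteq> {}"
    and "\<omega> > 0" and "F \<subseteq> {u \<in> C. norm u \<le> \<omega>}"
    and "\<And>n. \<alpha> n \<in> {0..1}" and "\<alpha> \<longlonglongrightarrow> 0"
    and "x 0 \<in> C"
    and "D 0 = C"
    and "\<And>n i. i \<in> {1..N} \<Longrightarrow>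
           y n i = inv duality_map (\<alpha> n *\<^sub>R duality_map (x 0)
                     + (1 - \<alpha> n) *\<^sub>R duality_map ((T i ^^ n) (x n)))"
    and "\<And>n. is_arg_max (\<lambda>i. norm (y n i - x n)) (\<lambda>i. i \<in> {1..N}) (ind n)"
    and "\<And>n. \<epsilon> n = (k n - 1) * (\<omega> + norm (x n))\<^sup>2"
    and "\<And>n. D (Suc n) = {v \<in> D n. lyapunov v (y n (ind n))
           \<le> \<alpha> n * lyapunov v (x 0) + (1 - \<alpha> n) * lyapunov v (x n) + \<epsilon> n}"
    and "\<And>n. x (Suc n) = gen_proj (D (Suc n)) (x 0)"
  shows "x \<longlonglongrightarrow> gen_proj F (x 0)"
proof -
  note us = assms(1) and uc = assms(2) and C = assms(3-5) and T = assms(7-9) and F = assms(10,11)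
    and F\<omega> = assms(13) and \<alpha>01 = assms(14) and \<alpha> = assms(15) and x0 = assms(16) and D0 = assms(17)
    and y = assms(18) and ind = assms(19) and \<epsilon> = assms(20) and DSuc = assms(21) and xSuc = assms(22)
  have \<alpha>01': "0 \<le> \<alpha> n" "\<alpha> n \<le> 1" for n using \<alpha>01[of n] by auto
  have ind1: "ind n \<in> {1..N}" for n using ind[of n] by (simp add: is_arg_max_def)
  have lip: "(L i)-lipschitz_on C (T i ^^ n)" if "i \<in> {1..N}" "1 \<le> n" for i n
    using T(3)[OF that(1)] that(2) by (simp add: uniformly_lipschitz_def)
  have cont: "continuous_on C (T i)" if "i \<in> {1..N}" for i
    using lipschitz_on_continuous_on[OF lip[OF that, of 1]] by simp
  have k: "k \<longlonglongrightarrow> 1" "\<And>n. 1 \<le> k n"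
    using T(2)[OF ind1] by (auto simp: asymp_quasi_phi_nonexpansive_def)
  \<comment> \<open>The hypothesis starts at \<open>n = 1\<close>; at \<open>n = 0\<close> the
    iterate is the identity and \<open>1 \<le> k 0\<close> suffices.\<close>
  have k_step: "lyapunov p ((T i ^^ n) v) \<le> k n * lyapunov p v"
    if "i \<in> {1..N}" "p \<in> F" "v \<in> C" for i n p v
  proof (cases "n = 0")
    case True
    then show ?thesis using k(2)[of 0] lyapunov_nonneg[OF us uc, of p v] by (simp add: mult_le_cancel_right1)
  next
    case False
    then show ?thesis using T(2)[OF that(1)] that F(1) by (auto simp: asymp_quasi_phi_nonexpansive_def)
  qed
  have Jy: "duality_map (y n i) = \<alpha> n *\<^sub>R duality_map (x 0) + (1 - \<alpha> n) *\<^sub>R duality_map ((T i ^^ n) (x n))"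
    if "i \<in> {1..N}" for n i
    unfolding y[OF that] by (rule surj_f_inv_f[OF surj_duality_map[OF us uc]])
  have convF: "convex F"
    unfolding F(1) using C T(1,2) cont by (intro convex_INT convex_fixed_points[OF us uc]) auto

  \<comment> \<open>The sets \<open>D n\<close> and convergence of the iterates\<close>
  have D_cc: "closed (D n) \<and> convex (D n)" for n
  proof (induction n)
    case 0
    then show ?case using D0 C by simp
  next
    case (Suc n)
    obtain h :: "'a \<Rightarrow>\<^sub>L real" and b where "{v. lyapunov v (y n (ind n))
        \<le> \<alpha> n * lyapunov v (x 0) + (1 - \<alpha> n) * lyapunov v (x n) + \<epsilon> n} = {v. blinfun_apply h v \<le> b}"
      by (rule lyapunov_half_space)
    then have "D (Suc n) = D n \<inter> {v. blinfun_apply h v \<le> b}"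
      unfolding DSuc by blast
    with Suc show ?case
      by (simp add: closed_Int convex_Int closed_blinfun_le convex_blinfun_le)
  qed
  have D_dec: "decseq D" by (rule decseq_SucI) (auto simp: DSuc)
  have DC: "D n \<subseteq> C" for n using decseqD[OF D_dec, of 0 n] D0 by simp
  \<comment> \<open>The two claims need a joint induction: \<open>F \<subseteq> D (Suc n)\<close>
    uses \<open>x n \<in> C\<close>, and it makes \<open>D (Suc n)\<close> nonempty, so that
    \<open>x (Suc n)\<close> is a genuine projection.\<close>
  have FD: "F \<subseteq> D n \<and> x n \<in> C" for n
  proof (induction n)
    case 0
    then show ?case using F\<omega> D0 x0 by auto
  next
    case (Suc n)
    have "F \<subseteq> D (Suc n)"
    proof
      fix p assume p: "p \<in> F"
      let ?w = "(T (ind n) ^^ n) (x n)"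
      have "lyapunov p (y n (ind n)) \<le> \<alpha> n * lyapunov p (x 0) + (1 - \<alpha> n) * lyapunov p ?w"
        by (rule lyapunov_dual_convex[OF us uc Jy[OF ind1] \<alpha>01'])
      also have "\<dots> \<le> \<alpha> n * lyapunov p (x 0) + (1 - \<alpha> n) * (k n * lyapunov p (x n))"
        using Suc \<alpha>01'[of n] k_step[OF ind1 p] by (intro add_left_mono mult_left_mono) auto
      also have "\<dots> = \<alpha> n * lyapunov p (x 0) + (1 - \<alpha> n) * lyapunov p (x n)
          + (1 - \<alpha> n) * ((k n - 1) * lyapunov p (x n))"
        by (simp add: algebra_simps)
      \<comment> \<open>The excess over the exact inequality is at most \<open>\<epsilon> n\<close>:
        this is what the term in the definition of \<open>D (Suc n)\<close> compensates.\<close>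
      also have "(1 - \<alpha> n) * ((k n - 1) * lyapunov p (x n)) \<le> 1 * ((k n - 1) * (\<omega> + norm (x n))\<^sup>2)"
      proof (intro mult_mono)
        have "lyapunov p (x n) \<le> (norm p + norm (x n))\<^sup>2" by (rule lyapunov_le[OF us uc])
        also have "\<dots> \<le> (\<omega> + norm (x n))\<^sup>2" using p F\<omega> by (intro power_mono) auto
        finally show "lyapunov p (x n) \<le> (\<omega> + norm (x n))\<^sup>2" .
      qed (use \<alpha>01'[of n] k(2)[of n] lyapunov_nonneg[OF us uc] in auto)
      finally show "p \<in> D (Suc n)" using Suc p by (auto simp: DSuc \<epsilon>)
    qed
    moreover have "x (Suc n) \<in> D (Suc n)"
      unfolding xSuc using calculation F(2) D_cc by (intro gen_proj_in[OF uc]) auto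
    ultimately show ?case using DC by blast
  qed
  obtain p where p: "p \<in> F" using F(2) by auto
  \<comment> \<open>The scheme defines projections only from index 1 on; at 0 the point
    \<open>x 0\<close> lies in \<open>D 0 = C\<close> and is its own projection.\<close>
  have proj: "x n = gen_proj (D n) (x 0)" for n
  proof (cases n)
    case 0
    have "gen_proj (D 0) (x 0) = x 0"
      using x0 D0 C by (intro gen_proj_eqI[OF uc]) (auto simp: lyapunov_self[OF us uc] lyapunov_nonneg[OF us uc])
    with 0 show ?thesis by simp
  qed (simp add: xSuc)
  have "convergent x"
    using D_cc D_dec FD p proj by (intro gen_proj_decreasing_convergent[OF us uc, of D p x "x 0"]) blast+
  then obtain z where z: "x \<longlonglongrightarrow> z" by (auto simp: convergent_def)
  have xD: "x n \<in> D n" for n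
    unfolding proj[of n] using FD D_cc p by (intro gen_proj_in[OF uc]) auto
  have zD: "z \<in> D n" for n
  proof (rule closed_sequentially)
    show "closed (D n)" using D_cc by simp
    show "x (m + n) \<in> D n" for m using xD decseqD[OF D_dec, of n "m + n"] by auto
    show "(\<lambda>m. x (m + n)) \<longlonglongrightarrow> z" using z by (rule LIMSEQ_ignore_initial_segment)
  qed
  then have zC: "z \<in> C" using DC by blast

  \<comment> \<open>The limit as a common fixed point and as the projection\<close>
  have "(\<lambda>n. lyapunov z (y n (ind n))) \<longlonglongrightarrow> 0"
  proof (rule tendsto_sandwich[OF always_eventually always_eventually tendsto_const])
    show "\<forall>n. 0 \<le> lyapunov z (y n (ind n))" by (simp add: lyapunov_nonneg[OF us uc])
    show "\<forall>n. lyapunov z (y n (ind n)) \<le> \<alpha> n * lyapunov z (x 0) + (1 - \<alpha> n) * lyapunov z (x n)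
        + (k n - 1) * (\<omega> + norm (x n))\<^sup>2"
      using zD DSuc \<epsilon> by auto
    show "(\<lambda>n. \<alpha> n * lyapunov z (x 0) + (1 - \<alpha> n) * lyapunov z (x n)
        + (k n - 1) * (\<omega> + norm (x n))\<^sup>2) \<longlonglongrightarrow> 0"
      by (rule tendsto_eq_intros \<alpha> k(1) z lyapunov_tendsto_0[OF us uc z] | simp)+
  qed
  then have "(\<lambda>n. y n (ind n)) \<longlonglongrightarrow> z" by (rule lyapunov_tendsto_0_imp[OF us uc])
  from tendsto_norm[OF tendsto_diff[OF this z]]
  have max0: "(\<lambda>n. norm (y n (ind n) - x n)) \<longlonglongrightarrow> 0" by simp
  have "z \<in> fixed_points C (T i)" if i: "i \<in> {1..N}" for i
  proof -
    \<comment> \<open>Maximality of \<open>ind n\<close> passes the limit on to every index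
      \<open>i\<close>.\<close>
    have "(\<lambda>n. y n i - x n) \<longlonglongrightarrow> 0"
    proof (rule Lim_null_comparison[OF always_eventually max0])
      show "\<forall>n. norm (y n i - x n) \<le> norm (y n (ind n) - x n)"
        using ind i by (simp add: is_arg_max_linorder)
    qed
    from tendsto_add[OF this z] have yi: "(\<lambda>n. y n i) \<longlonglongrightarrow> z" by simp
    \<comment> \<open>One Lipschitz constant serves all iterates, so \<open>x n\<close> may be
      replaced by \<open>z\<close> under \<open>T i ^^ n\<close> although the map changes with
      \<open>n\<close>.\<close>
    have diff0: "(\<lambda>n. (T i ^^ n) (x n) - (T i ^^ n) z) \<longlonglongrightarrow> 0"
    proof (rule Lim_null_comparison)
      show "\<forall>\<^sub>F n in sequentially. norm ((T i ^^ n) (x n) - (T i ^^ n) z) \<le> L i * dist (x n) z"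
        by (rule eventually_sequentiallyI[of 1])
          (use lipschitz_onD[OF lip[OF i]] zC FD in \<open>auto simp flip: dist_norm\<close>)
      show "(\<lambda>n. L i * dist (x n) z) \<longlonglongrightarrow> 0"
        by (rule tendsto_eq_intros z | simp)+
    qed
    \<comment> \<open>The iterates are compared with the common fixed point \<open>p\<close>, which
      \<open>T i ^^ n\<close> does not move; the Lipschitz bound is available from
      \<open>n = 1\<close> on.\<close>
    have "Bseq (\<lambda>n. (T i ^^ n) (x n))"
    proof -
      have fix_p: "(T i ^^ n) p = p" for n
        by (induction n) (use p F(1) i in \<open>auto simp: fixed_points_def\<close>)
      obtain B where B: "\<And>n. norm (x n) \<le> B"
        using convergent_imp_Bseq[OF \<open>convergent x\<close>] by (auto simp: Bseq_def)
      have "0 < L i" using T(3)[OF i] by (simp add: uniformly_lipschitz_def)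
      have "\<forall>\<^sub>F n in sequentially. norm ((T i ^^ n) (x n)) \<le> L i * (B + norm p) + norm p"
      proof (rule eventually_sequentiallyI)
        fix n :: nat assume "1 \<le> n"
        then have "dist ((T i ^^ n) (x n)) ((T i ^^ n) p) \<le> L i * dist (x n) p"
          using FD p F\<omega> by (intro lipschitz_onD[OF lip[OF i]]) auto
        also have "\<dots> \<le> L i * (B + norm p)"
          using \<open>0 < L i\<close> B[of n] norm_triangle_ineq4[of "x n" p] by (simp add: dist_norm)
        finally show "norm ((T i ^^ n) (x n)) \<le> L i * (B + norm p) + norm p"
          using norm_triangle_ineq2[of "(T i ^^ n) (x n)" p] by (simp add: fix_p dist_norm)
      qed
      then show ?thesis by (rule BfunI)
    qed
    then have "(\<lambda>n. (T i ^^ n) (x n)) \<longlonglongrightarrow> z"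
      by (rule tendsto_duality_perturbation[OF us uc yi \<alpha> _ Jy[OF i]])
    then have "(\<lambda>n. (T i ^^ n) z) \<longlonglongrightarrow> z"
      by (rule Lim_transform2[OF _ diff0])
    then show ?thesis using T(1)[OF i] cont[OF i] zC by (intro fixed_point_if_iterates_tendsto[OF us uc])
  qed
  then have "z \<in> F" using F(1) by auto
  \<comment> \<open>Each \<open>x n\<close> minimizes over \<open>D n\<close>, which contains
    \<open>F\<close>; the inequality survives the limit.\<close>
  moreover have "lyapunov z (x 0) \<le> lyapunov q (x 0)" if "q \<in> F" for q
  proof (rule LIMSEQ_le_const2[OF tendsto_lyapunov_left[OF z]])
    show "\<exists>M. \<forall>n\<ge>M. lyapunov (x n) (x 0) \<le> lyapunov q (x 0)"
      using gen_proj_le[OF uc, of "D _" q "x 0"] proj FD D_cc that by (metis empty_iff subsetD)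
  qed
  ultimately have "gen_proj F (x 0) = z" by (intro gen_proj_eqI[OF uc convF]) auto
  with z show ?thesis by simp
qed

end
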